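(* Assume that $w=(w_1,\dots,w_m)$ with $w=\partial_u E_{\mathrm{kin}}(u)$ is not constant in the element, i.e. not all of the vectors $w_1,\dots,w_m\in\mathbb{R}^n$ are scalar multiples of $\mathbf 1$. Define $$\mathfrak{r}_i=\alpha\left(w_i-\frac{\mathbf 1^T M w_i}{\mathbf 1^T M\mathbf 1}\,\mathbf 1\right),\quad i\in\{1,\dots,m\},\qquad\alpha=\frac{\mathcal{E}}{\sum_{k=1}^m\left(w_k^T M w_k-\frac{(\mathbf 1^T M w_k)^2}{\mathbf 1^T M\mathbf 1}\right)},$$ $$\mathcal{E}=\sum_j p^T M D_j v_j-\sum_j\mathbf 1^T R^T B N_j\bigl(F^{\mathrm{num},j}-S^{\mathrm{num},j}\bigr)-\sum_{k=1}^m w_k^T M\,\mathrm{VOL}_k-\sum_{k=1}^m w_k^T M\,\mathrm{SURF}_k.$$ Then $\mathfrak{r}=(\mathfrak{r}_1,\dots,\mathfrak{r}_m)$ is the unique optimal correction of the semidiscretization $\partial_t u_i=\mathrm{VOL}_i+\mathrm{SURF}_i+\mathfrak{r}_i$, measured in the discrete norm induced by $M$, such that local conservation and kinetic energy preservation are satisfied. That is, $\mathfrak{r}$ is the unique minimizer of $\frac12\|\mathfrak{r}\|_M^2=\frac12\sum_{i=1}^m\mathfrak{r}_i^T M\mathfrak{r}_i$ among all $\mathfrak{r}\in(\mathbb{R}^n)^m$ for which the corrected semidiscretization satisfies $$\mathbf 1^T M\,\partial_t u_i=-\sum_j\mathbf 1^T R^T B N_j f^{\mathrm{num},j}_i\quad\text{for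 all } i\in\{1,\dots,m\}$$ and $$\mathbf 1^T M\,\partial_t E_{\mathrm{kin}}=\sum_j p^T M D_j v_j-\sum_j\mathbf 1^T R^T B N_j\bigl(F^{\mathrm{num},j}-S^{\mathrm{num},j}\bigr).$$
   Context: Consider the compressible Euler equations in two space dimensions with conserved variables $u=(\varrho,\varrho v_x,\varrho v_y,\varrho e)$ ($m=4$), density $\varrho>0$, velocity $v=(v_x,v_y)$, specific total energy $e$, and pressure $p=(\gamma-1)(\varrho e-\frac12\varrho v^2)$ with $\gamma$ the ratio of specific heats; the index $j$ ranges over the two space directions. The kinetic energy is $E_{\mathrm{kin}}(u)=\frac12\varrho v^2=\frac12\varrho(v_x^2+v_y^2)$. Discretization on one element with $n$ nodes and $n_b$ boundary nodes, at a fixed time and for a given numerical state: $u_i\in\mathbb{R}^n$ is the vector of nodal values of the $i$-th conserved variable, $w_i\in\mathbb{R}^n$ the vector of nodal values of the $i$-th component of $w=\partial_u E_{\mathrm{kin}}(u)$, and $p,v_j\in\mathbb{R}^n$ the vectors of nodal values of pressure and of the $j$-th velocity component. $\partial_t E_{\mathrm{kin}}$ is the vector of nodal values $\partial_u E_{\mathrm{kin}}(u)\cdot\partial_t u$. $\mathbf 1$ is the vector all of whose entries are $1$. $M\in\mathbb{R}^{n\times n}$ is the mass matrix, symmetric positive definite and diagonal; $D_j\in\mathbb{R}^{n\times n}$ is the derivative matrix approximating $\partial_j$; $R\in\mathbb{R}^{n_b\times n}$ is the restriction/interpolation to the boundary nodes; $B\in\mathbb{R}^{n_b\times n_b}$ is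 the symmetric positive definite boundary mass matrix; $N_j\in\mathbb{R}^{n_b\times n_b}$ represents multiplication by the $j$-th component of the outer unit normal. $\mathrm{VOL}_i,\mathrm{SURF}_i\in\mathbb{R}^n$ are the volume and surface terms of a given baseline semidiscretization $\partial_t u_i=\mathrm{VOL}_i+\mathrm{SURF}_i$, and $f^{\mathrm{num},j}_i\in\mathbb{R}^{n_b}$ contains the boundary-node values of the numerical flux in direction $j$ for the $i$-th variable. The baseline is locally conservative: $\mathbf 1^T M(\mathrm{VOL}_i+\mathrm{SURF}_i)=-\sum_j\mathbf 1^T R^T B N_j f^{\mathrm{num},j}_i$ for every $i$. The boundary-node vectors $F^{\mathrm{num},j},S^{\mathrm{num},j}\in\mathbb{R}^{n_b}$ have the values $$F^{\mathrm{num},j}(u^-,u^+)=\frac12\sum_i v_i^-v_i^+\,f^{\mathrm{num},j}_\varrho(u^-,u^+)+\frac{p^+v_j^-+p^-v_j^+}{2},\qquad S^{\mathrm{num},j}(u^-,u^+)=p^-\,\frac{v_j^+-v_j^-}{2},$$ where $u^-$ is the value from the interior of the element, $u^+$ the value from the neighboring element, and $f^{\mathrm{num},j}_\varrho$ is the density component of the numerical flux. *)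

theory Defs
  imports "HOL-Analysis.Analysis"
begin

text \<open>
  A state in \<^typ>\<open>real^4\<close> has the components \<open>(\<rho>, \<rho> v\<^sub>x, \<rho> v\<^sub>y, \<rho> e)\<close> in this order. Nodal data for
  all conserved variables are of type \<^typ>\<open>real^'k^4\<close>: \<open>u $ i\<close> is the vector of nodal values of the
  \<open>i\<close>-th variable and \<open>column x u\<close> is the state at the node \<open>x\<close>. The type variables \<open>'n\<close> and \<open>'b\<close>
  index the nodes and the boundary nodes of the element, the type \<open>2\<close> indexes space directions.
\<close>

definition mass_density :: "real^4 \<Rightarrow> real" where
  "mass_density s = s $ 1"

definition velocity :: "real^4 \<Rightarrow> real^2" where
  "velocity s = vector [s $ 2 / mass_density s, s $ 3 / mass_density s]"

definition kinetic_energy :: "real^4 \<Rightarrow> real" where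
  "kinetic_energy s = 1/2 * mass_density s * (\<Sum>j\<in>UNIV. (velocity s $ j)\<^sup>2)"

definition pressure :: "real \<Rightarrow> real^4 \<Rightarrow> real" where
  "pressure \<gamma> s = (\<gamma> - 1) * (s $ 4 - 1/2 * mass_density s * (\<Sum>j\<in>UNIV. (velocity s $ j)\<^sup>2))"

definition grad_kinetic_energy :: "real^4 \<Rightarrow> real^4" where
  "grad_kinetic_energy s = (\<chi> i. frechet_derivative kinetic_energy (at s) (axis i 1))"

definition nodal_w :: "real^'n^4 \<Rightarrow> real^'n^4" where
  "nodal_w u = (\<chi> i x. grad_kinetic_energy (column x u) $ i)"

definition nodal_velocity :: "real^'n^4 \<Rightarrow> 2 \<Rightarrow> real^'n" where
  "nodal_velocity u j = (\<chi> x. velocity (column x u) $ j)"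

definition nodal_pressure :: "real \<Rightarrow> real^'n^4 \<Rightarrow> real^'n" where
  "nodal_pressure \<gamma> u = (\<chi> x. pressure \<gamma> (column x u))"

text \<open>The nodal values of \<open>\<partial>\<^sub>t E\<^sub>k\<^sub>i\<^sub>n = \<partial>\<^sub>u E\<^sub>k\<^sub>i\<^sub>n(u) \<cdot> \<partial>\<^sub>t u\<close>, where \<open>dtu\<close> stands for \<open>\<partial>\<^sub>t u\<close>.\<close>

definition dt_kinetic_energy :: "real^'n^4 \<Rightarrow> real^'n^4 \<Rightarrow> real^'n" where
  "dt_kinetic_energy u dtu = (\<chi> x. grad_kinetic_energy (column x u) \<bullet> column x dtu)"

definition sym_pos_def :: "real^'k^'k \<Rightarrow> bool" where
  "sym_pos_def A \<longleftrightarrow> transpose A = A \<and> (\<forall>x. x \<noteq> 0 \<longrightarrow> x \<bullet> (A *v x) > 0)"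

definition diagonal_matrix :: "real^'k^'k \<Rightarrow> bool" where
  "diagonal_matrix A \<longleftrightarrow> (\<forall>a b. a \<noteq> b \<longrightarrow> A $ a $ b = 0)"

text \<open>
  \<open>\<nu> $ j\<close> contains the \<open>j\<close>-th component of the outer unit normal at the boundary nodes, so that
  \<open>normal_matrix \<nu> j\<close> is the matrix \<open>N\<^sub>j\<close>.
\<close>

definition normal_matrix :: "real^'b^2 \<Rightarrow> 2 \<Rightarrow> real^'b^'b" where
  "normal_matrix \<nu> j = (\<chi> a b. if a = b then \<nu> $ j $ a else 0)"

text \<open>\<open>\<Sum>\<^sub>j 1\<^sup>T R\<^sup>T B N\<^sub>j g\<^sub>j\<close>\<close>

definition boundary_term ::
  "real^'n^'b \<Rightarrow> real^'b^'b \<Rightarrow> real^'b^2 \<Rightarrow> (2 \<Rightarrow> real^'b) \<Rightarrow> real" where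
  "boundary_term R B \<nu> g =
    (\<Sum>j\<in>UNIV. vec 1 \<bullet> (transpose R *v (B *v (normal_matrix \<nu> j *v g j))))"

definition boundary_values ::
  "(real^4 \<Rightarrow> real^4 \<Rightarrow> real) \<Rightarrow> real^'b^4 \<Rightarrow> real^'b^4 \<Rightarrow> real^'b" where
  "boundary_values h um up = (\<chi> b. h (column b um) (column b up))"

text \<open>
  In the following, \<open>fnum j\<close> is the numerical flux in direction \<open>j\<close>; its first argument is the state
  \<open>u\<^sup>-\<close> from the interior and its second argument the state \<open>u\<^sup>+\<close> from the neighbouring element.
  The traces \<open>um\<close> and \<open>up\<close> at the boundary nodes are arbitrary; no particular reconstruction (such as
  \<open>um $ i = R *v u $ i\<close>) is fixed.
\<close>

definition F_num ::
  "real \<Rightarrow> (2 \<Rightarrow> real^4 \<Rightarrow> real^4 \<Rightarrow> real^4) \<Rightarrow> 2 \<Rightarrow> real^4 \<Rightarrow> real^4 \<Rightarrow> real" where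
  "F_num \<gamma> fnum j sm sp =
    1/2 * (\<Sum>i\<in>UNIV. velocity sm $ i * velocity sp $ i) * fnum j sm sp $ 1
    + (pressure \<gamma> sp * velocity sm $ j + pressure \<gamma> sm * velocity sp $ j) / 2"

definition S_num :: "real \<Rightarrow> 2 \<Rightarrow> real^4 \<Rightarrow> real^4 \<Rightarrow> real" where
  "S_num \<gamma> j sm sp = pressure \<gamma> sm * ((velocity sp $ j - velocity sm $ j) / 2)"

text \<open>
  The right-hand side of the kinetic energy balance:
  \<open>\<Sum>\<^sub>j p\<^sup>T M D\<^sub>j v\<^sub>j - \<Sum>\<^sub>j 1\<^sup>T R\<^sup>T B N\<^sub>j (F\<^sup>n\<^sup>u\<^sup>m\<^sup>,\<^sup>j - S\<^sup>n\<^sup>u\<^sup>m\<^sup>,\<^sup>j)\<close>.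
\<close>

definition kinetic_energy_rate ::
  "real \<Rightarrow> real^'n^'n \<Rightarrow> (2 \<Rightarrow> real^'n^'n) \<Rightarrow> real^'n^'b \<Rightarrow> real^'b^'b \<Rightarrow> real^'b^2 \<Rightarrow>
   (2 \<Rightarrow> real^4 \<Rightarrow> real^4 \<Rightarrow> real^4) \<Rightarrow> real^'n^4 \<Rightarrow> real^'b^4 \<Rightarrow> real^'b^4 \<Rightarrow> real" where
  "kinetic_energy_rate \<gamma> M D R B \<nu> fnum u um up =
    (\<Sum>j\<in>UNIV. nodal_pressure \<gamma> u \<bullet> (M *v (D j *v nodal_velocity u j)))
    - boundary_term R B \<nu>
        (\<lambda>j. boundary_values (F_num \<gamma> fnum j) um up - boundary_values (S_num \<gamma> j) um up)"

definition locally_conservative ::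
  "real^'n^'n \<Rightarrow> real^'n^'b \<Rightarrow> real^'b^'b \<Rightarrow> real^'b^2 \<Rightarrow>
   (2 \<Rightarrow> real^4 \<Rightarrow> real^4 \<Rightarrow> real^4) \<Rightarrow> real^'b^4 \<Rightarrow> real^'b^4 \<Rightarrow> real^'n^4 \<Rightarrow> bool" where
  "locally_conservative M R B \<nu> fnum um up dtu \<longleftrightarrow>
    (\<forall>i. vec 1 \<bullet> (M *v (dtu $ i)) =
      - boundary_term R B \<nu> (\<lambda>j. boundary_values (\<lambda>sm sp. fnum j sm sp $ i) um up))"

definition kinetic_energy_preserving ::
  "real \<Rightarrow> real^'n^'n \<Rightarrow> (2 \<Rightarrow> real^'n^'n) \<Rightarrow> real^'n^'b \<Rightarrow> real^'b^'b \<Rightarrow> real^'b^2 \<Rightarrow>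
   (2 \<Rightarrow> real^4 \<Rightarrow> real^4 \<Rightarrow> real^4) \<Rightarrow> real^'n^4 \<Rightarrow> real^'b^4 \<Rightarrow> real^'b^4 \<Rightarrow> real^'n^4 \<Rightarrow> bool" where
  "kinetic_energy_preserving \<gamma> M D R B \<nu> fnum u um up dtu \<longleftrightarrow>
    vec 1 \<bullet> (M *v dt_kinetic_energy u dtu) = kinetic_energy_rate \<gamma> M D R B \<nu> fnum u um up"

definition norm_M_sq :: "real^'n^'n \<Rightarrow> real^'n^4 \<Rightarrow> real" where
  "norm_M_sq M r = (\<Sum>i\<in>UNIV. (r $ i) \<bullet> (M *v (r $ i)))"

definition energy_defect ::
  "real \<Rightarrow> real^'n^'n \<Rightarrow> (2 \<Rightarrow> real^'n^'n) \<Rightarrow> real^'n^'b \<Rightarrow> real^'b^'b \<Rightarrow> real^'b^2 \<Rightarrow>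
   (2 \<Rightarrow> real^4 \<Rightarrow> real^4 \<Rightarrow> real^4) \<Rightarrow> real^'n^4 \<Rightarrow> real^'b^4 \<Rightarrow> real^'b^4 \<Rightarrow>
   real^'n^4 \<Rightarrow> real^'n^4 \<Rightarrow> real" where
  "energy_defect \<gamma> M D R B \<nu> fnum u um up VOL SURF =
    kinetic_energy_rate \<gamma> M D R B \<nu> fnum u um up
    - (\<Sum>k\<in>UNIV. (nodal_w u $ k) \<bullet> (M *v (VOL $ k)))
    - (\<Sum>k\<in>UNIV. (nodal_w u $ k) \<bullet> (M *v (SURF $ k)))"

definition correction :: "real^'n^'n \<Rightarrow> real^'n^4 \<Rightarrow> real \<Rightarrow> real^'n^4" where
  "correction M w \<E> =
    (let \<alpha> = \<E> / (\<Sum>k\<in>UNIV. (w $ k) \<bullet> (M *v (w $ k))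
                   - (vec 1 \<bullet> (M *v (w $ k)))\<^sup>2 / (vec 1 \<bullet> (M *v vec 1)))
     in \<chi> i. \<alpha> *\<^sub>R (w $ i - ((vec 1 \<bullet> (M *v (w $ i))) / (vec 1 \<bullet> (M *v vec 1))) *\<^sub>R vec 1))"

end

theory Submission
  imports Defs
begin

text \<open>
  Since \<open>M\<close> is diagonal, \<open>1\<^sup>T M \<partial>\<^sub>t E\<^sub>k\<^sub>i\<^sub>n = \<langle>w, \<partial>\<^sub>t u\<rangle>\<close> for the inner product
  \<open>\<langle>r, s\<rangle> = \<Sum>\<^sub>i r\<^sub>i\<^sup>T M s\<^sub>i\<close>. Hence the admissible corrections are the \<open>r\<close> with all
  \<open>1\<^sup>T M r\<^sub>i = 0\<close> and \<open>\<langle>w, r\<rangle> = \<E>\<close>. If \<open>q\<close> denotes the part of \<open>w\<close> orthogonal to constants, this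
  says that \<open>r\<close> is orthogonal to constants and \<open>\<langle>q, r\<rangle> = \<E>\<close>. The correction \<open>(\<E> / \<langle>q, q\<rangle>) q\<close> is
  such an \<open>r\<close>, and Pythagoras' theorem shows that it is the one of least norm.
\<close>

definition mass_inner :: "real^'n^'n \<Rightarrow> real^'n^'m \<Rightarrow> real^'n^'m \<Rightarrow> real" where
  "mass_inner M r s = (\<Sum>i\<in>UNIV. (r $ i) \<bullet> (M *v (s $ i)))"

text \<open>For symmetric positive definite \<open>M\<close>, this is the componentwise
  \<open>M\<close>-orthogonal projection onto the complement of the constants.\<close>

definition mean_free_part :: "real^'n^'n \<Rightarrow> real^'n^'m \<Rightarrow> real^'n^'m" where
  "mean_free_part M w =
    (\<chi> i. w $ i - ((vec 1 \<bullet> (M *v (w $ i))) / (vec 1 \<bullet> (M *v vec 1))) *\<^sub>R vec 1)"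

lemma norm_M_sq_eq_mass_inner: "norm_M_sq M r = mass_inner M r r"
  by (simp add: norm_M_sq_def mass_inner_def)

lemma mass_inner_simps:
  "mass_inner M (r + r') s = mass_inner M r s + mass_inner M r' s"
  "mass_inner M r (s + s') = mass_inner M r s + mass_inner M r s'"
  "mass_inner M (r - r') s = mass_inner M r s - mass_inner M r' s"
  "mass_inner M r (s - s') = mass_inner M r s - mass_inner M r s'"
  "mass_inner M (a *\<^sub>R r) s = a * mass_inner M r s"
  "mass_inner M r (a *\<^sub>R s) = a * mass_inner M r s"
  by (simp_all add: mass_inner_def inner_left_distrib inner_right_distrib inner_diff_left
      inner_diff_right matrix_vector_right_distrib matrix_vector_mult_diff_distrib
      matrix_vector_mult_scaleR sum.distrib sum_subtractf sum_distrib_left)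

lemma inner_matrix_vector_commute:
  fixes M :: "real^'n^'n"
  assumes "transpose M = M"
  shows "x \<bullet> (M *v y) = y \<bullet> (M *v x)"
  by (metis assms dot_lmul_matrix inner_commute transpose_matrix_vector)

lemma mass_inner_commute:
  assumes "transpose M = M"
  shows "mass_inner M r s = mass_inner M s r"
  unfolding mass_inner_def by (intro sum.cong refl inner_matrix_vector_commute assms)

lemma mass_inner_pos:
  assumes "sym_pos_def M" "r \<noteq> 0"
  shows "mass_inner M r r > 0"
proof -
  have pos: "x \<bullet> (M *v x) > 0" if "x \<noteq> 0" for x
    using assms(1) that by (simp add: sym_pos_def_def)
  then have nonneg: "x \<bullet> (M *v x) \<ge> 0" for x
    by (cases "x = 0") (auto simp: less_imp_le)
  obtain i where "r $ i \<noteq> 0"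
    using assms(2) by (auto simp: vec_eq_iff)
  then show ?thesis
    unfolding mass_inner_def by (intro sum_pos2[of UNIV i] pos nonneg) auto
qed

lemma mass_one_pos:
  fixes M :: "real^'n^'n"
  assumes "sym_pos_def M"
  shows "vec 1 \<bullet> (M *v vec 1) > 0"
  using assms by (simp add: sym_pos_def_def vec_eq_iff)

lemma mean_free_part_conservative:
  assumes "sym_pos_def M"
  shows "vec 1 \<bullet> (M *v (mean_free_part M w $ i)) = 0"
  using mass_one_pos[OF assms]
  by (simp add: mean_free_part_def matrix_vector_mult_diff_distrib matrix_vector_mult_scaleR
      inner_diff_right)

text \<open>In each component, \<open>w\<close> and its projection differ by a multiple of
  \<open>vec 1\<close>, which pairs to zero with \<open>r\<close>.\<close>

lemma mass_inner_mean_free_part: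
  assumes "\<And>i. vec 1 \<bullet> (M *v (r $ i)) = 0"
  shows "mass_inner M (mean_free_part M w) r = mass_inner M w r"
  using assms by (simp add: mass_inner_def mean_free_part_def inner_diff_left)

text \<open>This identifies the denominator of \<alpha> as a squared norm, so that its positivity
  follows from that of \<open>M\<close>.\<close>

lemma mass_inner_mean_free_part_self:
  assumes "sym_pos_def M"
  shows "mass_inner M (mean_free_part M w) (mean_free_part M w) =
    (\<Sum>k\<in>UNIV. (w $ k) \<bullet> (M *v (w $ k)) - (vec 1 \<bullet> (M *v (w $ k)))\<^sup>2 / (vec 1 \<bullet> (M *v vec 1)))"
proof -
  have sym: "transpose M = M"
    using assms by (simp add: sym_pos_def_def)
  have "mass_inner M (mean_free_part M w) (mean_free_part M w) = mass_inner M w (mean_free_part M w)"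
    by (intro mass_inner_mean_free_part mean_free_part_conservative assms)
  also have "\<dots> = (\<Sum>k\<in>UNIV. (w $ k) \<bullet> (M *v (w $ k))
      - (vec 1 \<bullet> (M *v (w $ k)))\<^sup>2 / (vec 1 \<bullet> (M *v vec 1)))"
    unfolding mass_inner_def
  proof (intro sum.cong refl)
    fix k
    show "(w $ k) \<bullet> (M *v (mean_free_part M w $ k)) = (w $ k) \<bullet> (M *v (w $ k))
        - (vec 1 \<bullet> (M *v (w $ k)))\<^sup>2 / (vec 1 \<bullet> (M *v vec 1))"
      \<comment> \<open>Symmetry of \<open>M\<close> makes both factors of the subtracted term
        equal, hence the square.\<close>
      using inner_matrix_vector_commute[OF sym, of "w $ k" "vec 1"]
      by (simp add: mean_free_part_def matrix_vector_mult_diff_distrib matrix_vector_mult_scaleR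
          inner_diff_right power2_eq_square)
  qed
  finally show ?thesis .
qed

lemma correction_eq:
  assumes "sym_pos_def M"
  shows "correction M w \<E> =
    (\<E> / mass_inner M (mean_free_part M w) (mean_free_part M w)) *\<^sub>R mean_free_part M w"
  unfolding mass_inner_mean_free_part_self[OF assms]
  by (simp add: correction_def vec_eq_iff mean_free_part_def Let_def)

lemma inner_diagonal_matrix:
  assumes "diagonal_matrix M"
  shows "z \<bullet> (M *v y) = (\<Sum>x\<in>UNIV. M $ x $ x * (z $ x * y $ x))"
proof -
  have row: "(M *v y) $ x = M $ x $ x * y $ x" for x
  proof -
    have "(M *v y) $ x = (\<Sum>a\<in>UNIV. if a = x then M $ x $ x * y $ x else 0)"
      unfolding matrix_vector_mult_def vec_lambda_beta using assms
      by (intro sum.cong) (auto simp: diagonal_matrix_def)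
    then show ?thesis by simp
  qed
  show ?thesis
    by (simp add: inner_vec_def row mult_ac)
qed

text \<open>The chain rule product is taken node by node. A diagonal \<open>M\<close> only weights
  the nodes, so the sums over nodes and over variables can be exchanged.\<close>

lemma mass_dt_kinetic_energy:
  assumes "diagonal_matrix M"
  shows "vec 1 \<bullet> (M *v dt_kinetic_energy u d) = mass_inner M (nodal_w u) d"
proof -
  have "vec 1 \<bullet> (M *v dt_kinetic_energy u d) =
      (\<Sum>x\<in>UNIV. \<Sum>i\<in>UNIV. M $ x $ x * (nodal_w u $ i $ x * d $ i $ x))"
    unfolding inner_diagonal_matrix[OF assms]
    by (simp add: dt_kinetic_energy_def nodal_w_def inner_vec_def column_def sum_distrib_left)
  also have "\<dots> = mass_inner M (nodal_w u) d"
    unfolding mass_inner_def inner_diagonal_matrix[OF assms] by (rule sum.swap)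
  finally show ?thesis .
qed

text \<open>The second claim is an equality because its last term, the squared distance to the
  correction, also yields uniqueness.\<close>

lemma correction_minimal:
  fixes w :: "real^'n^4" and \<E> :: real
  assumes M: "sym_pos_def M" and "\<not> (\<forall>i. \<exists>c. w $ i = c *\<^sub>R vec 1)"
  defines "feasible \<equiv> \<lambda>r. (\<forall>i. vec 1 \<bullet> (M *v (r $ i)) = 0) \<and> mass_inner M w r = \<E>"
  shows "feasible (correction M w \<E>)"
    and "feasible r \<Longrightarrow>
      norm_M_sq M r = norm_M_sq M (correction M w \<E>) + norm_M_sq M (r - correction M w \<E>)"
proof -
  define q where "q = mean_free_part M w"
  define \<alpha> where "\<alpha> = \<E> / mass_inner M q q"
  have r_opt: "correction M w \<E> = \<alpha> *\<^sub>R q"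
    unfolding \<alpha>_def q_def by (rule correction_eq[OF M])
  \<comment> \<open>Nonconstancy of \<open>w\<close> enters here: it keeps the denominator of
    \<alpha> from vanishing.\<close>
  have "q \<noteq> 0"
  proof
    assume "q = 0"
    then have "w $ i = ((vec 1 \<bullet> (M *v (w $ i))) / (vec 1 \<bullet> (M *v vec 1))) *\<^sub>R vec 1" for i
      unfolding q_def mean_free_part_def vec_eq_iff[of _ "0 :: real^'n^4"] by simp
    with assms(2) show False by blast
  qed
  then have "mass_inner M q q > 0"
    by (rule mass_inner_pos[OF M])
  then have \<alpha>: "\<alpha> * mass_inner M q q = \<E>"
    by (simp add: \<alpha>_def)
  have q_cons: "vec 1 \<bullet> (M *v (q $ i)) = 0" for i
    unfolding q_def by (rule mean_free_part_conservative[OF M])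
  have "mass_inner M w q = mass_inner M q q"
    using mass_inner_mean_free_part[of M q w] q_cons by (simp add: q_def)
  then show "feasible (correction M w \<E>)"
    using q_cons \<alpha> unfolding feasible_def r_opt
    by (simp add: mass_inner_simps matrix_vector_mult_scaleR)
  assume "feasible r"
  then have "mass_inner M q r = \<E>"
    unfolding feasible_def q_def by (simp add: mass_inner_mean_free_part)
  moreover have "mass_inner M r q = mass_inner M q r"
    using M by (intro mass_inner_commute) (simp add: sym_pos_def_def)
  ultimately show "norm_M_sq M r =
      norm_M_sq M (correction M w \<E>) + norm_M_sq M (r - correction M w \<E>)"
    \<comment> \<open>The cross term vanishes: \<open>r\<close> and
      \<open>\<alpha> *\<^sub>R q\<close> both pair with \<open>q\<close> to \<open>\<E>\<close>, so
      their difference is orthogonal to \<open>q\<close>.\<close>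
    unfolding r_opt norm_M_sq_eq_mass_inner
    by (simp add: mass_inner_simps \<alpha>)
qed

theorem proposition3p5:
  fixes \<gamma> :: real
    and u :: "real^'n^4"
    and um up :: "real^'b^4"
    and M :: "real^'n^'n"
    and D :: "2 \<Rightarrow> real^'n^'n"
    and R :: "real^'n^'b"
    and B :: "real^'b^'b"
    and \<nu> :: "real^'b^2"
    and fnum :: "2 \<Rightarrow> real^4 \<Rightarrow> real^4 \<Rightarrow> real^4"
    and VOL SURF :: "real^'n^4"
  assumes "\<And>x. mass_density (column x u) > 0"
    and "\<And>b. mass_density (column b um) > 0"
    and "\<And>b. mass_density (column b up) > 0"
    and "sym_pos_def M" and "diagonal_matrix M"
    and "sym_pos_def B"
    and "\<And>b. norm (column b \<nu>) = 1"
    and "locally_conservative M R B \<nu> fnum um up (VOL + SURF)"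
    and "\<not> (\<forall>i. \<exists>c. nodal_w u $ i = c *\<^sub>R vec 1)"
  defines "admissible \<equiv> \<lambda>r. locally_conservative M R B \<nu> fnum um up (VOL + SURF + r) \<and>
      kinetic_energy_preserving \<gamma> M D R B \<nu> fnum u um up (VOL + SURF + r)"
    and "objective \<equiv> \<lambda>r. 1/2 * norm_M_sq M r"
    and "r_opt \<equiv> correction M (nodal_w u) (energy_defect \<gamma> M D R B \<nu> fnum u um up VOL SURF)"
  shows "is_arg_min objective admissible r_opt \<and>
    (\<forall>r. is_arg_min objective admissible r \<longrightarrow> r = r_opt)"
proof -
  define \<E> where "\<E> = energy_defect \<gamma> M D R B \<nu> fnum u um up VOL SURF"
  \<comment> \<open>The baseline already balances the boundary fluxes, which leaves a homogeneous
    condition on \<open>r\<close>.\<close>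
  have cons: "locally_conservative M R B \<nu> fnum um up (VOL + SURF + r) \<longleftrightarrow>
      (\<forall>i. vec 1 \<bullet> (M *v (r $ i)) = 0)" for r
    using assms(8)
    by (simp add: locally_conservative_def matrix_vector_right_distrib inner_right_distrib)
  \<comment> \<open>By linearity, \<open>r\<close> has to supply exactly what the baseline misses of
    the prescribed rate.\<close>
  have ekin: "kinetic_energy_preserving \<gamma> M D R B \<nu> fnum u um up (VOL + SURF + r) \<longleftrightarrow>
      mass_inner M (nodal_w u) r = \<E>" for r
    unfolding kinetic_energy_preserving_def mass_dt_kinetic_energy[OF assms(5)] mass_inner_simps
      \<E>_def energy_defect_def mass_inner_def[symmetric] by auto
  have adm: "admissible r \<longleftrightarrow>
      (\<forall>i. vec 1 \<bullet> (M *v (r $ i)) = 0) \<and> mass_inner M (nodal_w u) r = \<E>" for r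
    unfolding admissible_def cons ekin ..
  have r_opt: "r_opt = correction M (nodal_w u) \<E>"
    by (simp add: r_opt_def \<E>_def)
  have opt: "admissible r_opt"
    unfolding adm r_opt by (rule correction_minimal(1)[OF assms(4,9)])
  have pyth: "norm_M_sq M r = norm_M_sq M r_opt + norm_M_sq M (r - r_opt)" if "admissible r" for r
    using that unfolding adm r_opt by (rule correction_minimal(2)[OF assms(4,9)])
  have better: "objective r_opt < objective r" if "admissible r" "r \<noteq> r_opt" for r
    using pyth[OF that(1)] mass_inner_pos[OF assms(4), of "r - r_opt"] that(2)
    by (simp add: objective_def norm_M_sq_eq_mass_inner)
  \<comment> \<open>Strictness in \<open>better\<close> gives both claims: nothing admissible beats
    \<open>r_opt\<close>, and \<open>r_opt\<close> beats every other candidate.\<close>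
  show ?thesis
    using opt better unfolding is_arg_min_def by (metis less_asym less_irrefl)
qed

end
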